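(* Let $n$ be a positive integer and let $A=A_s+A_d\epsilon$ be an $n\times n$ dual number matrix, where $A_s$ is a real irreducible nonnegative matrix and $A_d$ is a real matrix. Then $A$ has a positive dual number eigenvalue $\lambda=\lambda_s+\lambda_d\epsilon$, where $\lambda_s$ is a positive real number and $\lambda_d$ is a real number, and an $n$-dimensional positive dual number eigenvector $\mathbf{x}=\mathbf{x}_s+\mathbf{x}_d\epsilon$ corresponding to $\lambda$, where $\mathbf{x}_s$ is a positive real $n$-dimensional vector and $\mathbf{x}_d$ is a real $n$-dimensional vector, such that $\lambda_s$ is an eigenvalue of $A_s$ with multiplicity $1$, and for any other dual complex eigenvalue $\mu=\mu_s+\mu_d\epsilon$ of $A$ we have $$\lambda_s\ge|\mu_s|.$$ Moreover, $$\lambda_d=\frac{\mathbf{y}_s^\top A_d\mathbf{x}_s}{\mathbf{y}_s^\top\mathbf{x}_s},$$ where $\mathbf{y}_s$ is the Perron eigenvector of $A_s^\top$, with $\mathbf{y}_s^\top\mathbf{x}_s>0$, and $$(A_s-\lambda_sI)\mathbf{x}_d=(\lambda_dI-A_d)\mathbf{x}_s.$$ If we require the $2$-norm of $\mathbf{x}$ to be $1$, then $\mathbf{x}_d$ is unique. Furthermore, writing $A=(a_{ij})$, we have $$\min_i\sum_{j=1}^na_{ij}\le\lambda\le\max_i\sum_{j=1}^na_{ij}.$$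
   Context: A dual complex number is $a=a_s+a_d\epsilon$ with $a_s,a_d\in\mathbb{C}$ (standard part and dual part), where $\epsilon\ne0$, $\epsilon^2=0$ and $\epsilon$ commutes with complex numbers; it is a dual number if $a_s,a_d\in\mathbb{R}$. Sums and products are $a+b=(a_s+b_s)+(a_d+b_d)\epsilon$, $ab=a_sb_s+(a_sb_d+a_db_s)\epsilon$. Vectors and matrices are written $\mathbf{x}=\mathbf{x}_s+\mathbf{x}_d\epsilon$, $A=A_s+A_d\epsilon$. Dual numbers are totally ordered by: $a>b$ if $a_s>b_s$, or $a_s=b_s$ and $a_d>b_d$; all inequalities, minima and maxima between dual numbers use this order. A dual complex number $\lambda$ is an eigenvalue of $A$ with eigenvector $\mathbf{x}$ (a dual complex vector) if $A\mathbf{x}=\lambda\mathbf{x}$ and $\mathbf{x}_s\neq\mathbf{0}$. For $\mathbf{x}_s\neq\mathbf{0}$ the $2$-norm is $\|\mathbf{x}\|_2=\|\mathbf{x}_s\|_2+\frac{\mathbf{x}_s^*\mathbf{x}_d}{\|\mathbf{x}_s\|_2}\epsilon$; for real parts, $\|\mathbf{x}\|_2=1$ means $\|\mathbf{x}_s\|_2=1$ and $\mathbf{x}_s^\top\mathbf{x}_d=0$. The Perron eigenvector of an irreducible nonnegative real matrix is an entrywise positive real eigenvector for its spectral radius. Convention: the $1\times1$ zero matrix is not regarded as irreducible. *)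

theory Defs
  imports Jordan_Normal_Form.Spectral_Radius
begin

section \<open>Dual numbers over a commutative ring\<close>

text \<open>\<open>Dual a b\<close> stands for \<open>a + b \<epsilon>\<close> with \<open>\<epsilon>\<^sup>2 = 0\<close>.  The instances \<open>real dual_number\<close> and
  \<open>complex dual_number\<close> are the dual numbers and the dual complex numbers.\<close>

datatype 'a dual_number = Dual (std_part: 'a) (dual_part: 'a)

instantiation dual_number :: (comm_ring_1) comm_ring_1
begin

definition "0 = Dual 0 0"
definition "1 = Dual 1 0"
definition "a + b = Dual (std_part a + std_part b) (dual_part a + dual_part b)"
definition "a - b = Dual (std_part a - std_part b) (dual_part a - dual_part b)"
definition "- a = Dual (- std_part a) (- dual_part a)"
definition "a * b =
  Dual (std_part a * std_part b) (std_part a * dual_part b + dual_part a * std_part b)"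

instance
  by standard
    (auto simp: zero_dual_number_def one_dual_number_def plus_dual_number_def
      minus_dual_number_def uminus_dual_number_def times_dual_number_def algebra_simps
      intro: dual_number.expand)

end

instantiation dual_number :: (linorder) linorder
begin

definition "a \<le> b \<longleftrightarrow>
  std_part a < std_part b \<or> std_part a = std_part b \<and> dual_part a \<le> dual_part b"
definition "a < b \<longleftrightarrow>
  std_part a < std_part b \<or> std_part a = std_part b \<and> dual_part a < dual_part b"

instance
  by standard
    (auto simp: less_eq_dual_number_def less_dual_number_def intro: dual_number.expand)

end

abbreviation dual_complex :: "real dual_number \<Rightarrow> complex dual_number" where
  "dual_complex \<equiv> map_dual_number complex_of_real"


section \<open>Eigenvalues and the 2-norm\<close>

text \<open>An eigenvector must have a nonzero standard part; this is stronger than being nonzero, so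
  the library's \<^const>\<open>eigenvector\<close> at type \<open>complex dual_number\<close> would be a different notion.\<close>

definition dual_eigenvector ::
  "complex dual_number mat \<Rightarrow> complex dual_number vec \<Rightarrow> complex dual_number \<Rightarrow> bool" where
  "dual_eigenvector A x lam \<longleftrightarrow>
     x \<in> carrier_vec (dim_row A) \<and> map_vec std_part x \<noteq> 0\<^sub>v (dim_row A) \<and> A *\<^sub>v x = lam \<cdot>\<^sub>v x"

definition dual_eigenvalue :: "complex dual_number mat \<Rightarrow> complex dual_number \<Rightarrow> bool" where
  "dual_eigenvalue A lam \<longleftrightarrow> (\<exists>x. dual_eigenvector A x lam)"

text \<open>Only meaningful for vectors with nonzero standard part.  As \<open>u \<bullet>c v\<close> conjugates its second
  argument, the numerator of the dual part is \<open>x\<^sub>s\<^sup>* x\<^sub>d\<close>.\<close>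

definition dual_norm2 :: "complex dual_number vec \<Rightarrow> complex dual_number" where
  "dual_norm2 x =
     (let xs = map_vec std_part x; xd = map_vec dual_part x;
          r = complex_of_real (sqrt (\<Sum>i<dim_vec x. (cmod (xs $ i))\<^sup>2))
      in Dual r ((xd \<bullet>c xs) / r))"

definition pos_dual_eigenvector ::
  "real dual_number mat \<Rightarrow> real dual_number vec \<Rightarrow> real dual_number \<Rightarrow> bool" where
  "pos_dual_eigenvector A x lam \<longleftrightarrow>
     x \<in> carrier_vec (dim_row A) \<and> (\<forall>i < dim_row A. 0 < x $ i \<and> 0 < std_part (x $ i)) \<and>
     dual_eigenvector (map_mat dual_complex A) (map_vec dual_complex x) (dual_complex lam)"


section \<open>Irreducible nonnegative matrices\<close>

definition nonneg_real_mat :: "real mat \<Rightarrow> bool" where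
  "nonneg_real_mat B \<longleftrightarrow> (\<forall>i < dim_row B. \<forall>j < dim_col B. 0 \<le> B $$ (i, j))"

text \<open>A square matrix is reducible if some nonempty proper set \<open>I\<close> of indices has no nonzero entry
  in the rows of \<open>I\<close> and the columns outside \<open>I\<close>, that is, if a simultaneous permutation of rows
  and columns makes it block triangular.  By convention the \<open>1 \<times> 1\<close> zero matrix is not
  irreducible.\<close>

definition irreducible_mat :: "real mat \<Rightarrow> bool" where
  "irreducible_mat B \<longleftrightarrow>
     square_mat B \<and>
     \<not> (\<exists>I. I \<noteq> {} \<and> I \<subset> {..<dim_row B} \<and>
          (\<forall>i \<in> I. \<forall>j \<in> {..<dim_row B} - I. B $$ (i, j) = 0)) \<and>
     B \<noteq> 0\<^sub>m 1 1"

definition perron_eigenvector :: "real mat \<Rightarrow> real vec \<Rightarrow> bool" where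
  "perron_eigenvector B y \<longleftrightarrow>
     (\<forall>i < dim_row B. 0 < y $ i) \<and>
     eigenvector B y (spectral_radius (map_mat complex_of_real B))"

end

theory Submission
  imports Defs
begin

text \<open>
Why the theorem holds.  Split the eigenvalue equation of \<open>A = As + Ad \<epsilon>\<close> into its standard and dual
parts (lemma \<open>dual_eigen_equation_iff\<close>):
  \<open>As xs = \<rho> xs\<close> and \<open>As xd + Ad xs = \<rho> xd + l xs\<close>.
The first equation is the classical Perron-Frobenius problem, the second is the equation of
first-order perturbation theory at a simple eigenvalue.

For the first, take absolute values in a complex eigenvector of an eigenvalue of maximal modulus
\<open>\<rho>\<close>.  The result is a nonnegative vector \<open>u\<close> with \<open>As u \<ge> \<rho> u\<close>.  By irreducibility a strict inequality
in one coordinate could be spread to all of them, and powers of \<open>As\<close> would grow faster than the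
spectral radius permits (\<open>subinvariant_le_spectral_radius\<close>, \<open>not_strictly_subinvariant\<close>).  So \<open>u\<close> is an
eigenvector; irreducibility makes it positive and the eigenspace one-dimensional.  The same holds
for the transpose, which provides a positive left eigenvector \<open>y\<close>.

For the second, \<open>y \<bullet> xs > 0\<close> has two consequences, drawn over any field in the locale
\<open>simple_eigenpair\<close>: \<open>\<rho>\<close> is a simple root of the characteristic polynomial (\<open>order_char_poly\<close>), and
\<open>(As - \<rho>) z = b\<close> is solvable as soon as \<open>y \<bullet> b = 0\<close> (\<open>solvable\<close>).  Orthogonality to \<open>y\<close> fixes
\<open>l = (y \<bullet> Ad xs) / (y \<bullet> xs)\<close>, the solution \<open>xd\<close> is determined up to multiples of \<open>xs\<close>, and the norm
condition selects one of them.  Any other eigenvalue of \<open>A\<close> has an eigenvalue of \<open>As\<close> as its standard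
part, hence the bound by \<open>\<rho>\<close>.

For the row sums, the construction applied to the transpose gives a left dual eigenvector with
positive standard part for the same dual eigenvalue.  It exhibits the eigenvalue as a weighted
average of the row sums over the dual numbers (\<open>row_sums_bound_eigenvalue\<close>).
\<close>

section \<open>Simple eigenvalues\<close>

lemma mult_mat_vec_index_sum:
  fixes A :: "'a :: comm_ring_1 mat"
  assumes "A \<in> carrier_mat n n" and "x \<in> carrier_vec n" and "i < n"
  shows "(A *\<^sub>v x) $ i = (\<Sum>j<n. A $$ (i, j) * x $ j)"
  using assms by (auto simp: scalar_prod_def atLeast0LessThan intro!: sum.cong)

lemma smult_one_mult_mat_vec:
  fixes v :: "'a :: comm_ring_1 vec"
  assumes "v \<in> carrier_vec n"
  shows "(k \<cdot>\<^sub>m 1\<^sub>m n) *\<^sub>v v = k \<cdot>\<^sub>v v"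
  using assms by (intro eq_vecI) auto

text \<open>The algebraic core of first-order perturbation theory: an eigenvalue \<open>a\<close> whose eigenspace is the
line through \<open>x\<close>, together with a left eigenvector \<open>y\<close> that is not orthogonal to \<open>x\<close>.  The condition
\<open>y \<bullet> x \<noteq> 0\<close> is what rules out Jordan blocks: \<open>y\<close> annihilates the range of \<open>A - a\<close>, so \<open>x\<close> is not in
that range.\<close>

locale simple_eigenpair =
  fixes n :: nat and A :: "'a :: field mat" and a :: 'a and x y :: "'a vec"
  assumes A: "A \<in> carrier_mat n n"
    and x: "x \<in> carrier_vec n" and y: "y \<in> carrier_vec n"
    and right: "A *\<^sub>v x = a \<cdot>\<^sub>v x"
    and left: "transpose_mat A *\<^sub>v y = a \<cdot>\<^sub>v y"
    and yx: "y \<bullet> x \<noteq> 0"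
    and kernel: "\<And>v. v \<in> carrier_vec n \<Longrightarrow> A *\<^sub>v v = a \<cdot>\<^sub>v v \<Longrightarrow> \<exists>t. v = t \<cdot>\<^sub>v x"
begin

lemma left_annihilates:
  assumes v: "v \<in> carrier_vec n"
  shows "y \<bullet> (A *\<^sub>v v) = a * (y \<bullet> v)"
  using transpose_vec_mult_scalar[OF A v y] left y v by simp

lemma y_smult_x: "y \<bullet> (t \<cdot>\<^sub>v x) = t * (y \<bullet> x)"
  using x y by simp

text \<open>Applying \<open>y\<close> to both sides of the equation cancels \<open>a * (y \<bullet> v)\<close> and leaves \<open>t * (y \<bullet> x) = 0\<close>.\<close>

lemma no_generalized_eigenvector:
  assumes v: "v \<in> carrier_vec n" and Av: "A *\<^sub>v v = a \<cdot>\<^sub>v v + t \<cdot>\<^sub>v x"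
  shows "\<exists>s. v = s \<cdot>\<^sub>v x"
proof -
  have "a * (y \<bullet> v) = y \<bullet> (a \<cdot>\<^sub>v v + t \<cdot>\<^sub>v x)"
    using left_annihilates[OF v] Av by simp
  also have "\<dots> = a * (y \<bullet> v) + t * (y \<bullet> x)"
    using v x y by (simp add: scalar_prod_add_distrib[of y n])
  finally have "t = 0" using yx by simp
  with Av have "A *\<^sub>v v = a \<cdot>\<^sub>v v" using v x by (auto simp: vec_eq_iff)
  from kernel[OF v this] show ?thesis .
qed

text \<open>The Fredholm alternative for \<open>A - a\<close>.  The rank-one correction \<open>C = A - a - x y\<^sup>T\<close> turns the
singular matrix into an invertible one, because \<open>y\<close> maps \<open>C v\<close> to \<open>- (y \<bullet> v) * (y \<bullet> x)\<close>: whenever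
\<open>y\<close> annihilates \<open>C v\<close>, it annihilates \<open>v\<close> too, and the correction term vanishes at \<open>v\<close>.  This
observation gives both the injectivity of \<open>C\<close> and the fact that the solution of \<open>C z = b\<close> solves the
original system.\<close>

lemma solvable:
  assumes b: "b \<in> carrier_vec n" and yb: "y \<bullet> b = 0"
  shows "\<exists>z \<in> carrier_vec n. A *\<^sub>v z = a \<cdot>\<^sub>v z + b"
proof -
  define C where "C = mat n n (\<lambda>(i,j). A $$ (i,j) - (if i = j then a else 0) - x $ i * y $ j)"
  have C: "C \<in> carrier_mat n n" by (simp add: C_def)
  have Cv: "C *\<^sub>v v = A *\<^sub>v v - a \<cdot>\<^sub>v v - (y \<bullet> v) \<cdot>\<^sub>v x" if v: "v \<in> carrier_vec n" for v
  proof (rule eq_vecI)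
    fix i assume "i < dim_vec (A *\<^sub>v v - a \<cdot>\<^sub>v v - (y \<bullet> v) \<cdot>\<^sub>v x)"
    hence i: "i < n" using x by simp
    have "(C *\<^sub>v v) $ i = (\<Sum>j<n. A $$ (i,j) * v $ j - (if i = j then a * v $ i else 0) - x $ i * (y $ j * v $ j))"
      unfolding mult_mat_vec_index_sum[OF C v i] using i
      by (intro sum.cong) (auto simp: C_def algebra_simps)
    also have "\<dots> = (\<Sum>j<n. A $$ (i,j) * v $ j) - (\<Sum>j<n. if i = j then a * v $ i else 0)
        - (\<Sum>j<n. x $ i * (y $ j * v $ j))"
      by (simp only: sum_subtractf)
    also have "(\<Sum>j<n. if i = j then a * v $ i else 0) = a * v $ i" using i by simp
    also have "(\<Sum>j<n. x $ i * (y $ j * v $ j)) = x $ i * (y \<bullet> v)"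
      using v by (simp add: scalar_prod_def atLeast0LessThan sum_distrib_left)
    also have "(\<Sum>j<n. A $$ (i,j) * v $ j) - a * v $ i - x $ i * (y \<bullet> v) =
        (A *\<^sub>v v - a \<cdot>\<^sub>v v - (y \<bullet> v) \<cdot>\<^sub>v x) $ i"
      using i v x A mult_mat_vec_index_sum[OF A v i] by (simp del: index_mult_mat_vec)
    finally show "(C *\<^sub>v v) $ i = (A *\<^sub>v v - a \<cdot>\<^sub>v v - (y \<bullet> v) \<cdot>\<^sub>v x) $ i" .
  qed (use C x in auto)
  have yC: "y \<bullet> (C *\<^sub>v v) = - (y \<bullet> v) * (y \<bullet> x)" if v: "v \<in> carrier_vec n" for v
    unfolding Cv[OF v] using v x y A left_annihilates[OF v]
    by (simp add: scalar_prod_minus_distrib[of y n])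
  have kill: "A *\<^sub>v v = a \<cdot>\<^sub>v v + C *\<^sub>v v" "y \<bullet> v = 0"
    if v: "v \<in> carrier_vec n" and 0: "y \<bullet> (C *\<^sub>v v) = 0" for v
  proof -
    show yv: "y \<bullet> v = 0" using yC[OF v] 0 yx by simp
    show "A *\<^sub>v v = a \<cdot>\<^sub>v v + C *\<^sub>v v"
      unfolding Cv[OF v] yv using v x A by (auto simp: vec_eq_iff)
  qed
  have "det C \<noteq> 0"
  proof
    assume "det C = 0"
    then obtain v where v: "v \<in> carrier_vec n" "v \<noteq> 0\<^sub>v n" "C *\<^sub>v v = 0\<^sub>v n"
      using det_0_iff_vec_prod_zero_field[OF C] by auto
    have "y \<bullet> (C *\<^sub>v v) = 0" using v y by simp
    from kill[OF v(1) this] v have Av: "A *\<^sub>v v = a \<cdot>\<^sub>v v" and yv: "y \<bullet> v = 0" by auto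
    from kernel[OF v(1) Av] obtain t where t: "v = t \<cdot>\<^sub>v x" by auto
    with yv y_smult_x yx have "t = 0" by simp
    with t v(2) x show False by (auto simp: vec_eq_iff)
  qed
  from det_non_zero_imp_unit[OF C this]
  obtain D where D: "D \<in> carrier_mat n n" "C * D = 1\<^sub>m n"
    by (auto simp: Units_def ring_mat_simps)
  define z where "z = D *\<^sub>v b"
  have z: "z \<in> carrier_vec n" using D b by (simp add: z_def)
  have "C *\<^sub>v z = b"
    using assoc_mult_mat_vec[OF C D(1) b] D b by (simp add: z_def)
  with kill(1)[OF z] yb z show ?thesis by auto
qed

text \<open>In a basis that starts with \<open>x\<close> the matrix has first column \<open>a e\<^sub>0\<close>, so the characteristic
polynomial splits off the factor \<open>X - a\<close>.  An eigenvector of the remaining block for \<open>a\<close> would lift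
to a vector \<open>v\<close> with \<open>(A - a) v\<close> on the line of \<open>x\<close> that is not itself on that line.\<close>

lemma order_char_poly: "order a (char_poly A) = 1"
proof -
  have "x \<noteq> 0\<^sub>v n" using yx y by auto
  then obtain k where k: "k < n" "x $ k \<noteq> 0" using x by (auto simp: vec_eq_iff)
  then obtain m where n: "n = Suc m" by (cases n) auto
  \<comment> \<open>The columns of \<open>P\<close> are \<open>x\<close> and the unit vectors other than \<open>e\<^sub>k\<close>; as \<open>x $ k \<noteq> 0\<close>, they form a
    basis.  The unit vector \<open>e\<^sub>0\<close>, displaced by \<open>x\<close>, takes the place of \<open>e\<^sub>k\<close>.\<close>
  define P where "P = mat n n (\<lambda>(i,j). if j = 0 then x $ i else
      if i = (if j = k then 0 else j) then 1 else 0)"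
  have P: "P \<in> carrier_mat n n" by (simp add: P_def)
  define e :: "'a vec" where "e = unit_vec n 0"
  have e: "e \<in> carrier_vec n" by (simp add: e_def)
  have Pe: "P *\<^sub>v e = x"
  proof (rule eq_vecI)
    fix i assume "i < dim_vec x"
    hence i: "i < n" using x by simp
    show "(P *\<^sub>v e) $ i = x $ i"
      unfolding mult_mat_vec_index_sum[OF P e i] using i n
      by (simp add: P_def e_def if_distrib unit_vec_def cong: if_cong)
  qed (use P x in auto)
  have "det P \<noteq> 0"
  proof
    assume "det P = 0"
    then obtain v where v: "v \<in> carrier_vec n" "v \<noteq> 0\<^sub>v n" "P *\<^sub>v v = 0\<^sub>v n"
      using det_0_iff_vec_prod_zero_field[OF P] by auto
    have entry: "(\<Sum>j<n. P $$ (i,j) * v $ j) = 0" if "i < n" for i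
      using mult_mat_vec_index_sum[OF P v(1) that] v that by simp
    have Pk: "P $$ (k,j) * v $ j = (if j = 0 then x $ k * v $ 0 else 0)" if "j < n" for j
      using that k by (auto simp: P_def)
    have "(\<Sum>j<n. P $$ (k,j) * v $ j) = (\<Sum>j<n. if j = 0 then x $ k * v $ 0 else 0)"
      using Pk by (intro sum.cong) auto
    hence "x $ k * v $ 0 = 0" using entry[OF k(1)] n by (simp del: sum.lessThan_Suc)
    hence v0: "v $ 0 = 0" using k by simp
    have "v $ j = 0" if j: "j < n" for j
    proof (cases "j = 0")
      case False
      let ?i = "if j = k then 0 else j"
      have i: "?i < n" using j n by auto
      have "P $$ (?i,j') * v $ j' = (if j' = j then v $ j else 0)" if "j' < n" for j'
        using that i False v0 by (auto simp: P_def split: if_splits)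
      hence "(\<Sum>j'<n. P $$ (?i,j') * v $ j') = (\<Sum>j'<n. if j' = j then v $ j else 0)"
        by (intro sum.cong) auto
      with entry[OF i] j show ?thesis by simp
    qed (use v0 in simp)
    with v show False by (auto simp: vec_eq_iff)
  qed
  from det_non_zero_imp_unit[OF P this]
  obtain Q where Q: "Q \<in> carrier_mat n n" and PQ: "P * Q = 1\<^sub>m n" and QP: "Q * P = 1\<^sub>m n"
    by (auto simp: Units_def ring_mat_simps)
  define B where "B = Q * A * P"
  have B: "B \<in> carrier_mat n n" using Q A P by (simp add: B_def)
  have PB: "P * B = A * P"
  proof -
    have "P * B = (P * Q) * (A * P)" using P Q A by (simp add: B_def assoc_mult_mat[of _ n n _ n _ n])
    thus ?thesis using PQ A P by simp
  qed
  have "P * B * Q = A"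
    unfolding PB using assoc_mult_mat[OF A P Q] PQ A by simp
  hence "similar_mat_wit A B P Q"
    by (intro similar_mat_witI[of _ _ n]) (use PQ QP A B P Q in auto)
  hence sim: "char_poly A = char_poly B"
    by (intro char_poly_similar) (auto simp: similar_mat_def)
  have ABv: "P *\<^sub>v (B *\<^sub>v v) = A *\<^sub>v (P *\<^sub>v v)" if "v \<in> carrier_vec n" for v
    using assoc_mult_mat_vec[OF P B that] assoc_mult_mat_vec[OF A P that] PB by simp
  have inj: "v = w" if "P *\<^sub>v v = P *\<^sub>v w" "v \<in> carrier_vec n" "w \<in> carrier_vec n" for v w
    using that assoc_mult_mat_vec[OF Q P, of v] assoc_mult_mat_vec[OF Q P, of w] QP
    by (metis one_mult_mat_vec)
  have Be: "B *\<^sub>v e = a \<cdot>\<^sub>v e"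
    by (rule inj) (use ABv[OF e] Pe right B e P in \<open>auto simp: mult_mat_vec\<close>)
  have B0: "B $$ (i,0) = (if i = 0 then a else 0)" if i: "i < n" for i
  proof -
    have "(B *\<^sub>v e) $ i = B $$ (i,0)"
      unfolding mult_mat_vec_index_sum[OF B e i] using i n
      by (simp add: e_def if_distrib unit_vec_def cong: if_cong)
    with Be i show ?thesis using n by (auto simp: e_def split: if_splits)
  qed
  obtain B1 B2 B3 B4 where split: "split_block B 1 1 = (B1,B2,B3,B4)" by (metis prod_cases4)
  have dims: "dim_row B = 1 + m" "dim_col B = 1 + m" using B n by auto
  note S = split_block[OF split dims]
  have "B1 = mat 1 1 (\<lambda>ij. B $$ ij)" "B3 = mat m 1 (\<lambda>(i,j). B $$ (i + 1, j))"
    using split dims by (auto simp: split_block_def Let_def)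
  hence B1: "B1 = mat 1 1 (\<lambda>_. a)" and B3: "B3 = 0\<^sub>m m 1"
    using B0 n by (auto intro!: eq_matI)
  have cp: "char_poly A = char_poly B1 * char_poly B4"
    using char_poly_four_block_zeros_col[OF S(1,2,4)] S(5) B3 sim by simp
  have cp1: "char_poly B1 = [:-a, 1:]"
    by (simp add: char_poly_defs B1 det_single)
  have "\<not> eigenvalue B4 a"
  proof
    assume "eigenvalue B4 a"
    then obtain w where w: "w \<in> carrier_vec m" "w \<noteq> 0\<^sub>v m" and Bw: "B4 *\<^sub>v w = a \<cdot>\<^sub>v w"
      unfolding eigenvalue_def eigenvector_def carrier_matD(1)[OF S(4)] by blast
    define v where "v = 0\<^sub>v 1 @\<^sub>v w"
    have v: "v \<in> carrier_vec n" 
      using append_carrier_vec[OF zero_carrier_vec w(1), of 1] n by (simp add: v_def)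
    have "B *\<^sub>v v = (B1 *\<^sub>v 0\<^sub>v 1 + B2 *\<^sub>v w) @\<^sub>v (B3 *\<^sub>v 0\<^sub>v 1 + B4 *\<^sub>v w)"
      unfolding v_def S(5) by (rule four_block_mat_mult_vec[OF S(1-4)]) (use w in auto)
    also have "B1 *\<^sub>v 0\<^sub>v 1 = 0\<^sub>v 1" by (simp add: B1 vec_eq_iff scalar_prod_def)
    also have "(0\<^sub>v 1 + B2 *\<^sub>v w) @\<^sub>v (B3 *\<^sub>v 0\<^sub>v 1 + B4 *\<^sub>v w) = a \<cdot>\<^sub>v v + ((B2 *\<^sub>v w) $ 0) \<cdot>\<^sub>v e"
      using S w n by (auto simp: vec_eq_iff Bw v_def e_def B3 unit_vec_def)
    finally have Bv: "B *\<^sub>v v = a \<cdot>\<^sub>v v + ((B2 *\<^sub>v w) $ 0) \<cdot>\<^sub>v e" .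
    have "A *\<^sub>v (P *\<^sub>v v) = a \<cdot>\<^sub>v (P *\<^sub>v v) + ((B2 *\<^sub>v w) $ 0) \<cdot>\<^sub>v x"
      unfolding ABv[OF v, symmetric] Bv Pe[symmetric]
      using v e P by (simp add: mult_add_distrib_mat_vec[OF P] mult_mat_vec)
    from no_generalized_eigenvector[OF _ this] v P
    obtain s where "P *\<^sub>v v = s \<cdot>\<^sub>v x" by auto
    also have "\<dots> = P *\<^sub>v (s \<cdot>\<^sub>v e)" using Pe mult_mat_vec[OF P e] by simp
    finally have ve: "v = s \<cdot>\<^sub>v e" by (rule inj) (use v e in auto)
    have "w $ i = 0" if "i < m" for i
      using arg_cong[OF ve, of "\<lambda>u. u $ Suc i"] that w n by (simp add: v_def e_def)
    with w show False by (auto simp: vec_eq_iff)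
  qed
  hence "poly (char_poly B4) a \<noteq> 0" using eigenvalue_root_char_poly[OF S(4)] by simp
  hence "order a (char_poly B4) = 0" and nz: "char_poly B4 \<noteq> 0" by (auto simp: order_0I)
  moreover have "order a [:-a, 1:] = 1" using order_power_n_n[of a 1] by simp
  moreover have "[:-a, 1:] * char_poly B4 \<noteq> 0"
    using nz by (metis mult_eq_0_iff pCons_eq_0_iff zero_neq_one)
  ultimately show ?thesis unfolding cp cp1 by (simp add: order_mult del: mult_pCons_left)
qed

end


section \<open>Irreducible nonnegative real matrices\<close>

lemma spectral_radius_nonneg:
  assumes "C \<in> carrier_mat n n" and "0 < n"
  shows "0 \<le> spectral_radius C"
  using spectral_radius_mem_max(1)[OF assms] by auto

text \<open>The lower Collatz-Wielandt bound.  If \<open>q\<close> exceeded the spectral radius, there would be an \<open>s\<close>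
strictly between the two.  The powers of \<open>A / s\<close> are then bounded, since its spectral radius is
below 1, but the iterates of \<open>w\<close> under \<open>A / s\<close> grow at least like \<open>(q / s)\<^sup>m\<close>.\<close>

lemma subinvariant_le_spectral_radius:
  fixes A :: "real mat" and w :: "real vec"
  assumes A: "A \<in> carrier_mat n n"
    and nonneg: "\<And>i j. i < n \<Longrightarrow> j < n \<Longrightarrow> 0 \<le> A $$ (i, j)"
    and w: "w \<in> carrier_vec n" and w0: "\<And>i. i < n \<Longrightarrow> 0 \<le> w $ i" and wnz: "w \<noteq> 0\<^sub>v n"
    and q: "\<And>i. i < n \<Longrightarrow> q * w $ i \<le> (A *\<^sub>v w) $ i"
  shows "q \<le> spectral_radius (map_mat complex_of_real A)"
proof (rule ccontr)
  let ?cA = "map_mat complex_of_real A"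
  assume "\<not> ?thesis"
  moreover have cA: "?cA \<in> carrier_mat n n" using A by simp
  from wnz w obtain k where k: "k < n" "w $ k \<noteq> 0" by (auto simp: vec_eq_iff)
  with w0 have wk: "0 < w $ k" by (metis less_eq_real_def)
  from k have n: "0 < n" by simp
  have "0 \<le> spectral_radius ?cA" by (rule spectral_radius_nonneg[OF cA n])
  ultimately obtain s where s: "spectral_radius ?cA < s" "s < q" "0 < s"
    by (meson dense not_le le_less_trans)
  define B where "B = (1 / s) \<cdot>\<^sub>m A"
  let ?cB = "map_mat complex_of_real B"
  have B: "B \<in> carrier_mat n n" and cB: "?cB \<in> carrier_mat n n" using A by (auto simp: B_def)
  have "spectral_radius ?cB < 1"
  proof -
    obtain b where b: "b \<in> spectrum ?cB" "spectral_radius ?cB = norm b"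
      using spectral_radius_mem_max(1)[OF cB n] by auto
    then obtain v where v: "v \<in> carrier_vec n" "v \<noteq> 0\<^sub>v n" "?cB *\<^sub>v v = b \<cdot>\<^sub>v v"
      using B by (auto simp: spectrum_def eigenvalue_def eigenvector_def)
    have "?cA = of_real s \<cdot>\<^sub>m ?cB" using s A by (auto simp: B_def mat_eq_iff)
    hence "?cA *\<^sub>v v = of_real s \<cdot>\<^sub>v (?cB *\<^sub>v v)" using v B by (auto simp: vec_eq_iff)
    hence "eigenvector ?cA v (of_real s * b)"
      using v A by (auto simp: eigenvector_def smult_smult_assoc)
    hence "norm (of_real s * b) \<le> spectral_radius ?cA"
      by (intro spectral_radius_mem_max(2)[OF cA n] imageI) (auto simp: spectrum_def eigenvalue_def)
    hence "s * spectral_radius ?cB \<le> spectral_radius ?cA" using s b by (simp add: norm_mult)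
    also note s(1)
    finally show ?thesis using s(3) by simp
  qed
  from spectral_radius_jnf_norm_bound_less_1_upper_triangular[OF cB this]
  obtain c where c: "\<And>m. norm_bound (?cB ^\<^sub>m m) c" by auto
  have Bm: "B ^\<^sub>m m \<in> carrier_mat n n" for m using B by simp
  have entry: "(B ^\<^sub>m m) $$ (i, j) \<le> c" if "i < n" "j < n" for m i j
  proof -
    have "?cB ^\<^sub>m m \<in> carrier_mat n n" using cB by (rule pow_carrier_mat)
    with c[of m] that have "norm ((?cB ^\<^sub>m m) $$ (i, j)) \<le> c"
      unfolding norm_bound_def by (metis carrier_matD)
    moreover have "(?cB ^\<^sub>m m) $$ (i, j) = of_real ((B ^\<^sub>m m) $$ (i, j))"
      unfolding of_real_hom.mat_hom_pow[OF B, symmetric]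
      by (rule index_map_mat) (use Bm[of m] that in \<open>simp_all only: carrier_matD\<close>)
    ultimately have "\<bar>(B ^\<^sub>m m) $$ (i, j)\<bar> \<le> c" by (simp only: norm_of_real)
    thus ?thesis by linarith
  qed
  define r where "r = q / s"
  have r: "1 < r" using s by (simp add: r_def)
  have Bnn: "0 \<le> B $$ (i,j)" if "i < n" "j < n" for i j
    using nonneg[OF that] that A s by (simp add: B_def)
  have grow: "r ^ m * w $ i \<le> (B ^\<^sub>m m *\<^sub>v w) $ i" if "i < n" for m i
    using that
  proof (induction m arbitrary: i)
    case 0
    thus ?case using w B by simp
  next
    case (Suc m)
    define u where "u = B ^\<^sub>m m *\<^sub>v w"
    have u: "u \<in> carrier_vec n" using Bm[of m] w by (simp add: u_def)
    have comm: "B ^\<^sub>m Suc m = B * B ^\<^sub>m m"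
    proof (induction m)
      case (Suc m)
      thus ?case using assoc_mult_mat[OF B Bm[of m] B] by simp
    qed (use B in simp)
    have "r ^ Suc m * w $ i = r ^ m * (q * w $ i / s)" by (simp add: r_def)
    also have "\<dots> \<le> r ^ m * ((A *\<^sub>v w) $ i / s)"
      using q[OF Suc.prems] s r by (intro mult_left_mono divide_right_mono) auto
    also have "\<dots> = (\<Sum>j<n. B $$ (i,j) * (r ^ m * w $ j))"
      unfolding mult_mat_vec_index_sum[OF A w Suc.prems] using Suc.prems A
      by (simp add: B_def sum_distrib_left sum_divide_distrib mult_ac)
    also have "\<dots> \<le> (\<Sum>j<n. B $$ (i,j) * u $ j)"
      using Suc by (intro sum_mono mult_left_mono) (auto simp: Bnn u_def)
    also have "\<dots> = (B *\<^sub>v u) $ i" using mult_mat_vec_index_sum[OF B u Suc.prems] by simp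
    also have "B *\<^sub>v u = B ^\<^sub>m Suc m *\<^sub>v w"
      unfolding comm u_def using assoc_mult_mat_vec[OF B Bm[of m] w] by simp
    finally show ?case .
  qed
  obtain m where m: "c * (\<Sum>j<n. w $ j) / w $ k < r ^ m"
    using real_arch_pow[OF r] by blast
  have "r ^ m * w $ k \<le> (\<Sum>j<n. (B ^\<^sub>m m) $$ (k,j) * w $ j)"
    using grow[OF k(1), of m] mult_mat_vec_index_sum[OF Bm w k(1)] by simp
  also have "\<dots> \<le> (\<Sum>j<n. c * w $ j)"
    using k w0 by (intro sum_mono mult_right_mono entry) auto
  finally have "r ^ m \<le> c * (\<Sum>j<n. w $ j) / w $ k"
    unfolding sum_distrib_left[symmetric] pos_le_divide_eq[OF wk] .
  with m show False by linarith
qed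

locale irreducible_nonneg =
  fixes n :: nat and A :: "real mat"
  assumes n: "0 < n" and A: "A \<in> carrier_mat n n"
    and nonneg: "\<And>i j. i < n \<Longrightarrow> j < n \<Longrightarrow> 0 \<le> A $$ (i, j)"
    and irreducible: "irreducible_mat A"
begin

abbreviation \<rho> where "\<rho> \<equiv> spectral_radius (map_mat complex_of_real A)"

text \<open>Irreducibility in the form of strong connectivity: every nonempty proper set of indices has an
edge leading out of it.\<close>

lemma leaving_entry:
  assumes "I \<noteq> {}" and "I \<subset> {..<n}"
  obtains i j where "i \<in> I" "j < n" "j \<notin> I" "0 < A $$ (i, j)"
proof -
  obtain i j where ij: "i \<in> I" "j \<in> {..<n} - I" "A $$ (i, j) \<noteq> 0"
    using irreducible assms A unfolding irreducible_mat_def by (metis carrier_matD(1))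
  with nonneg[of i j] assms have "0 < A $$ (i, j)" by force
  with ij that show ?thesis by auto
qed

text \<open>In a row \<open>i\<close> with \<open>x $ i = 0\<close> the eigenvalue equation is a vanishing sum of nonnegative terms, so
\<open>A\<close> has no positive entry from the zero set of \<open>x\<close> to its complement; by irreducibility the zero set
is empty.\<close>

lemma nonneg_eigenvector_pos:
  assumes x: "x \<in> carrier_vec n" "\<And>i. i < n \<Longrightarrow> 0 \<le> x $ i" "x \<noteq> 0\<^sub>v n"
    and ev: "A *\<^sub>v x = a \<cdot>\<^sub>v x" and i: "i < n"
  shows "0 < x $ i"
proof -
  define I where "I = {i. i < n \<and> x $ i = 0}"
  have "I = {}"
  proof (rule ccontr)
    assume "I \<noteq> {}"
    moreover have "I \<subset> {..<n}" using x by (auto simp: I_def vec_eq_iff)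
    ultimately obtain i j where ij: "i \<in> I" "j < n" "j \<notin> I" "0 < A $$ (i, j)"
      by (rule leaving_entry)
    hence i: "i < n" "x $ i = 0" by (auto simp: I_def)
    have "(\<Sum>j<n. A $$ (i, j) * x $ j) = 0"
      using mult_mat_vec_index_sum[OF A x(1) i(1)] ev i x by simp
    hence "A $$ (i, j) * x $ j = 0"
      using sum_nonneg_0[of "{..<n}" "\<lambda>j. A $$ (i, j) * x $ j" j] i ij nonneg x by simp
    with ij show False by (simp add: I_def)
  qed
  with x(2)[OF i] i show ?thesis by (force simp: I_def)
qed

text \<open>A nonnegative vector with \<open>A u \<ge> \<rho> u\<close> must satisfy \<open>A u = \<rho> u\<close>.  Let \<open>d = A u - \<rho> u\<close> be the defect.
If \<open>d\<close> were positive in all coordinates, then \<open>A u \<ge> (\<rho> + \<delta>) u\<close> for some \<open>\<delta> > 0\<close>, against the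
Collatz-Wielandt bound.  Otherwise \<open>u + A u\<close> has defect \<open>d + A d\<close>, which is positive wherever \<open>d\<close> is
and, by irreducibility, in at least one more coordinate; hence the induction on the number of
zeros of the defect.\<close>

lemma not_strictly_subinvariant:
  assumes u: "u \<in> carrier_vec n" "\<And>i. i < n \<Longrightarrow> 0 \<le> u $ i"
    and sub: "\<And>i. i < n \<Longrightarrow> \<rho> * u $ i \<le> (A *\<^sub>v u) $ i"
    and k: "k < n" "\<rho> * u $ k < (A *\<^sub>v u) $ k"
  shows False
  using assms
proof (induction "card {i. i < n \<and> (A *\<^sub>v u) $ i = \<rho> * u $ i}" arbitrary: u k rule: less_induct)
  case less
  note u = less.prems(1,2) and sub = less.prems(3) and k = less.prems(4,5)
  define I where "I = {i. i < n \<and> (A *\<^sub>v u) $ i = \<rho> * u $ i}"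
  have fin: "finite I" by (simp add: I_def)
  have Au: "A *\<^sub>v u \<in> carrier_vec n" using A u by simp
  have Aun: "0 \<le> (A *\<^sub>v u) $ i" if "i < n" for i
    unfolding mult_mat_vec_index_sum[OF A u(1) that] using that u nonneg by (intro sum_nonneg) auto
  show False
  proof (cases "I = {}")
    case True
    hence strict: "\<rho> * u $ i < (A *\<^sub>v u) $ i" if "i < n" for i
      using sub[OF that] that by (force simp: I_def)
    \<comment> \<open>The summand 1 keeps the denominator positive where \<open>u\<close> vanishes.\<close>
    define d where "d = Min ((\<lambda>i. ((A *\<^sub>v u) $ i - \<rho> * u $ i) / (1 + u $ i)) ` {..<n})"
    have dpos: "0 < d" 
      unfolding d_def using n strict u(2)
      by (subst Min_gr_iff) (auto intro!: divide_pos_pos add_pos_nonneg simp del: index_mult_mat_vec)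
    have "(\<rho> + d) * u $ i \<le> (A *\<^sub>v u) $ i" if i: "i < n" for i
    proof -
      have "d \<le> ((A *\<^sub>v u) $ i - \<rho> * u $ i) / (1 + u $ i)"
        unfolding d_def using i by (intro Min_le) auto
      hence "d * (1 + u $ i) \<le> (A *\<^sub>v u) $ i - \<rho> * u $ i"
        using u(2)[OF i] by (simp add: pos_le_divide_eq)
      with dpos show ?thesis by (simp add: algebra_simps)
    qed
    moreover have "u \<noteq> 0\<^sub>v n"
    proof
      assume "u = 0\<^sub>v n"
      hence "u $ j = 0" if "j < n" for j using that by simp
      with strict[OF n] n show False unfolding mult_mat_vec_index_sum[OF A u(1) n] by simp
    qed
    ultimately have "\<rho> + d \<le> \<rho>"
      using subinvariant_le_spectral_radius[OF A nonneg u(1) u(2)] by blast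
    with dpos show False by simp
  next
    case False
    have "I \<subseteq> {..<n}" and "k \<in> {..<n} - I" unfolding I_def using k by auto
    hence "I \<subset> {..<n}" by blast
    with False obtain i j where ij: "i \<in> I" "j < n" "j \<notin> I" "0 < A $$ (i, j)"
      by (rule leaving_entry)
    define d where "d = A *\<^sub>v u - \<rho> \<cdot>\<^sub>v u"
    define v where "v = u + A *\<^sub>v u"
    have d: "d \<in> carrier_vec n" and v: "v \<in> carrier_vec n" using Au u by (auto simp: d_def v_def)
    have d0: "0 \<le> d $ i" if "i < n" for i using sub[OF that] that u Au by (simp add: d_def del: index_mult_mat_vec)
    have Ad0: "0 \<le> (A *\<^sub>v d) $ i" if "i < n" for i
      unfolding mult_mat_vec_index_sum[OF A d that] using that d0 nonneg by (intro sum_nonneg) auto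
    have defect: "(A *\<^sub>v v) $ i - \<rho> * v $ i = d $ i + (A *\<^sub>v d) $ i" if "i < n" for i
    proof -
      have "A *\<^sub>v v = A *\<^sub>v u + A *\<^sub>v (A *\<^sub>v u)"
        unfolding v_def using mult_add_distrib_mat_vec[OF A u(1) Au] .
      moreover have "A *\<^sub>v d = A *\<^sub>v (A *\<^sub>v u) - \<rho> \<cdot>\<^sub>v (A *\<^sub>v u)"
        unfolding d_def using mult_minus_distrib_mat_vec[OF A Au, of "\<rho> \<cdot>\<^sub>v u"] mult_mat_vec[OF A u(1)] u by simp
      ultimately show ?thesis
        using that u A Au by (simp add: d_def v_def algebra_simps del: index_mult_mat_vec)
    qed
    have "{i. i < n \<and> (A *\<^sub>v v) $ i = \<rho> * v $ i} \<subseteq> I - {i}"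
    proof -
      have "l \<in> I" if "l < n" "(A *\<^sub>v v) $ l = \<rho> * v $ l" for l
      proof -
        from defect[OF that(1)] that d0[OF that(1)] Ad0[OF that(1)] have "d $ l = 0" by linarith
        with that u Au show ?thesis by (simp add: I_def d_def del: index_mult_mat_vec)
      qed
      moreover have "(A *\<^sub>v v) $ i \<noteq> \<rho> * v $ i"
      proof
        assume eq: "(A *\<^sub>v v) $ i = \<rho> * v $ i"
        have i: "i < n" using ij by (simp add: I_def)
        from defect[OF i] eq d0[OF i] Ad0[OF i] have "(A *\<^sub>v d) $ i = 0" by linarith
        hence "A $$ (i, j) * d $ j = 0"
          using sum_nonneg_0[of "{..<n}" "\<lambda>j. A $$ (i, j) * d $ j" j] i ij nonneg d0
            mult_mat_vec_index_sum[OF A d i] by simp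
        hence "d $ j = 0" using ij by simp
        with ij u Au show False by (simp add: I_def d_def del: index_mult_mat_vec)
      qed
      ultimately show ?thesis by blast
    qed
    hence "card {i. i < n \<and> (A *\<^sub>v v) $ i = \<rho> * v $ i} < card I"
      using fin ij by (metis card_Diff1_less card_mono finite_Diff le_less_trans)
    moreover have "0 \<le> v $ l" if "l < n" for l
      using that u(2)[OF that] A Aun[OF that] by (simp add: v_def del: index_mult_mat_vec)
    moreover have "\<rho> * v $ l \<le> (A *\<^sub>v v) $ l" if "l < n" for l
      using defect[OF that] d0[OF that] Ad0[OF that] by linarith
    moreover have "\<rho> * v $ k < (A *\<^sub>v v) $ k"
    proof -
      have "0 < d $ k" using k u Au by (simp add: d_def del: index_mult_mat_vec)
      with defect[OF k(1)] Ad0[OF k(1)] show ?thesis by linarith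
    qed
    ultimately show False using less.hyps[of v k] v k(1) unfolding I_def by blast
  qed
qed

text \<open>For a complex eigenvector \<open>z\<close> of an eigenvalue of maximal modulus, the triangle inequality gives
\<open>A |z| \<ge> \<rho> |z|\<close>, which is an equality by the preceding lemma.\<close>

lemma positive_eigenvector:
  obtains x where "x \<in> carrier_vec n" "\<And>i. i < n \<Longrightarrow> 0 < x $ i" "A *\<^sub>v x = \<rho> \<cdot>\<^sub>v x"
proof -
  let ?cA = "map_mat complex_of_real A"
  have cA: "?cA \<in> carrier_mat n n" using A by simp
  obtain b where "b \<in> spectrum ?cA" and b: "\<rho> = norm b"
    using spectral_radius_mem_max(1)[OF cA n] by auto
  then obtain z where z: "z \<in> carrier_vec n" "z \<noteq> 0\<^sub>v n" "?cA *\<^sub>v z = b \<cdot>\<^sub>v z"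
    using A by (auto simp: spectrum_def eigenvalue_def eigenvector_def)
  define u where "u = map_vec norm z"
  have u: "u \<in> carrier_vec n" "\<And>i. i < n \<Longrightarrow> 0 \<le> u $ i" and unz: "u \<noteq> 0\<^sub>v n"
    using z by (auto simp: u_def vec_eq_iff)
  have sub: "\<rho> * u $ i \<le> (A *\<^sub>v u) $ i" if i: "i < n" for i
  proof -
    have "\<rho> * u $ i = norm ((?cA *\<^sub>v z) $ i)" using z i by (simp add: b u_def norm_mult)
    also have "\<dots> \<le> (\<Sum>j<n. norm (?cA $$ (i, j) * z $ j))"
      unfolding mult_mat_vec_index_sum[OF cA z(1) i] by (rule norm_sum)
    also have "\<dots> = (\<Sum>j<n. A $$ (i, j) * u $ j)"
      using i A z nonneg by (intro sum.cong) (auto simp: u_def norm_mult)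
    also have "\<dots> = (A *\<^sub>v u) $ i" using mult_mat_vec_index_sum[OF A u(1) i] by simp
    finally show ?thesis .
  qed
  have "(A *\<^sub>v u) $ i = \<rho> * u $ i" if "i < n" for i
    using not_strictly_subinvariant[OF u sub that] sub[OF that] by force
  hence "A *\<^sub>v u = \<rho> \<cdot>\<^sub>v u" using u A by (intro eq_vecI) (auto simp del: index_mult_mat_vec)
  from nonneg_eigenvector_pos[OF u unz this] this u(1) show ?thesis by (intro that)
qed

text \<open>The only irreducible candidate without a positive entry is the \<open>1 \<times> 1\<close> zero matrix, which the
convention excludes; for every other matrix a positive entry makes some coordinate of
\<open>A x = \<rho> x\<close> positive.\<close>

lemma spectral_radius_pos: "0 < \<rho>"
proof -
  obtain x where x: "x \<in> carrier_vec n" "\<And>i. i < n \<Longrightarrow> 0 < x $ i" "A *\<^sub>v x = \<rho> \<cdot>\<^sub>v x"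
    using positive_eigenvector by blast
  have "\<exists>i j. i < n \<and> j < n \<and> 0 < A $$ (i, j)"
  proof (cases "n = 1")
    case True
    have "A \<noteq> 0\<^sub>m 1 1" using irreducible unfolding irreducible_mat_def by blast
    with A True have "A $$ (0, 0) \<noteq> 0" by (auto simp: mat_eq_iff)
    with nonneg[of 0 0] True have "0 < A $$ (0, 0)" by simp
    with True show ?thesis by blast
  next
    case False
    with n have "1 < n" by linarith
    hence "0 \<in> {..<n}" "1 \<in> {..<n}" by simp_all
    moreover have "1 \<notin> {0::nat}" by simp
    ultimately have "{0} \<subset> {..<n}" by (metis empty_subsetI insert_subset psubsetI)
    then obtain i j where "i \<in> {0}" "j < n" "0 < A $$ (i, j)"
      by (rule leaving_entry[of "{0}", OF insert_not_empty])
    with n show ?thesis by (metis singletonD)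
  qed
  then obtain i j where ij: "i < n" "j < n" "0 < A $$ (i, j)" by blast
  have "0 < A $$ (i, j) * x $ j" using ij x by simp
  also have "\<dots> \<le> (\<Sum>j<n. A $$ (i, j) * x $ j)"
    using ij by (intro member_le_sum mult_nonneg_nonneg nonneg less_imp_le[OF x(2)]) auto
  also have "\<dots> = \<rho> * x $ i"
    using mult_mat_vec_index_sum[OF A x(1) ij(1)] x ij by simp
  finally show ?thesis using x(2)[OF ij(1)] by (simp add: zero_less_mult_iff)
qed

text \<open>Subtract from \<open>z\<close> the largest multiple of \<open>x\<close> that keeps the difference nonnegative.  The difference
has a zero coordinate and lies in the eigenspace; were it nonzero, it would be strictly positive.\<close>

lemma eigenspace_one_dimensional:
  assumes x: "x \<in> carrier_vec n" "\<And>i. i < n \<Longrightarrow> 0 < x $ i" "A *\<^sub>v x = a \<cdot>\<^sub>v x"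
    and z: "z \<in> carrier_vec n" "A *\<^sub>v z = a \<cdot>\<^sub>v z"
  shows "\<exists>t. z = t \<cdot>\<^sub>v x"
proof -
  define t where "t = Min ((\<lambda>i. z $ i / x $ i) ` {..<n})"
  have "t \<in> (\<lambda>i. z $ i / x $ i) ` {..<n}" unfolding t_def using n by (intro Min_in) auto
  then obtain k where k: "k < n" "t = z $ k / x $ k" by auto
  define u where "u = z - t \<cdot>\<^sub>v x"
  have u: "u \<in> carrier_vec n" using x z by (simp add: u_def)
  have Au: "A *\<^sub>v u = a \<cdot>\<^sub>v u"
  proof -
    have "A *\<^sub>v u = a \<cdot>\<^sub>v z - t \<cdot>\<^sub>v (a \<cdot>\<^sub>v x)"
      unfolding u_def using x z mult_minus_distrib_mat_vec[OF A z(1), of "t \<cdot>\<^sub>v x"] mult_mat_vec[OF A x(1), of t]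
      by simp
    also have "\<dots> = a \<cdot>\<^sub>v u" using x(1) z(1) by (simp add: u_def vec_eq_iff algebra_simps)
    finally show ?thesis .
  qed
  have u0: "0 \<le> u $ i" if i: "i < n" for i
  proof -
    have "t \<le> z $ i / x $ i" unfolding t_def using i by (intro Min_le) auto
    thus ?thesis using i x(1) x(2)[OF i] z by (simp add: u_def pos_le_divide_eq)
  qed
  have "u $ k = 0" using k x(1) x(2)[OF k(1)] z by (simp add: u_def)
  with nonneg_eigenvector_pos[OF u u0 _ Au k(1)] have "u = 0\<^sub>v n" by auto
  hence "z = t \<cdot>\<^sub>v x" using x z by (auto simp: u_def vec_eq_iff)
  thus ?thesis ..
qed

lemma irreducible_nonneg_transpose: "irreducible_nonneg n (transpose_mat A)"
proof
  show "irreducible_mat (transpose_mat A)"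
    unfolding irreducible_mat_def
  proof (intro conjI notI)
    show "square_mat (transpose_mat A)" using A by simp
    assume "transpose_mat A = 0\<^sub>m 1 1"
    hence "A = 0\<^sub>m 1 1" by (metis Matrix.transpose_transpose zero_transpose_mat)
    with irreducible show False by (simp add: irreducible_mat_def)
  next
    assume "\<exists>I. I \<noteq> {} \<and> I \<subset> {..<dim_row (transpose_mat A)} \<and>
      (\<forall>i\<in>I. \<forall>j\<in>{..<dim_row (transpose_mat A)} - I. transpose_mat A $$ (i, j) = 0)"
    moreover have "dim_row (transpose_mat A) = n" using A by simp
    ultimately obtain I where I: "I \<noteq> {}" "I \<subset> {..<n}"
      and "\<forall>i\<in>I. \<forall>j\<in>{..<n} - I. transpose_mat A $$ (i, j) = 0"
      by auto
    hence zero: "A $$ (j, i) = 0" if "i \<in> I" "j < n" "j \<notin> I" for i j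
      using that A by (metis DiffI carrier_matD index_transpose_mat(1) lessThan_iff psubsetD)
    have "{..<n} - I \<noteq> {}" "{..<n} - I \<subset> {..<n}" using I by auto
    then obtain i j where "i \<in> {..<n} - I" "j < n" "j \<notin> {..<n} - I" "0 < A $$ (i, j)"
      by (rule leaving_entry)
    with zero[of j i] show False by auto
  qed
qed (use n A nonneg in auto)

lemma spectral_radius_transpose:
  "spectral_radius (map_mat complex_of_real (transpose_mat A)) = \<rho>"
proof -
  let ?cA = "map_mat complex_of_real A"
  have cA: "?cA \<in> carrier_mat n n" using A by simp
  have "map_mat complex_of_real (transpose_mat A) = transpose_mat ?cA" using A by (auto simp: mat_eq_iff)
  moreover have "spectrum (transpose_mat ?cA) = spectrum ?cA"
    using spectrum_root_char_poly[OF cA] spectrum_root_char_poly[of "transpose_mat ?cA" n] cA by simp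
  ultimately show ?thesis by (simp add: spectral_radius_def)
qed

lemma positive_left_eigenvector:
  obtains y where "y \<in> carrier_vec n" "\<And>i. i < n \<Longrightarrow> 0 < y $ i"
    "transpose_mat A *\<^sub>v y = \<rho> \<cdot>\<^sub>v y"
  by (rule irreducible_nonneg.positive_eigenvector[OF irreducible_nonneg_transpose,
        unfolded spectral_radius_transpose]) (rule that)

lemma positive_eigenpair_simple:
  assumes x: "x \<in> carrier_vec n" "\<And>i. i < n \<Longrightarrow> 0 < x $ i" "A *\<^sub>v x = a \<cdot>\<^sub>v x"
    and y: "y \<in> carrier_vec n" "\<And>i. i < n \<Longrightarrow> 0 < y $ i" "transpose_mat A *\<^sub>v y = a \<cdot>\<^sub>v y"
  shows "simple_eigenpair n A a x y"
proof
  have "0 < y \<bullet> x"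
    unfolding scalar_prod_def using x y n by (intro sum_pos) auto
  thus "y \<bullet> x \<noteq> 0" by simp
qed (fact A x y | rule eigenspace_one_dimensional[OF x]; assumption)+

end


section \<open>Matrices over the dual numbers\<close>

lemma std_part_simps [simp]:
  "std_part 0 = 0" "std_part 1 = 1" "std_part (a + b) = std_part a + std_part b"
  "std_part (a - b) = std_part a - std_part b" "std_part (a * b) = std_part a * std_part b"
  by (simp_all add: zero_dual_number_def one_dual_number_def plus_dual_number_def
      minus_dual_number_def times_dual_number_def)

lemma dual_part_simps [simp]:
  "dual_part 0 = 0" "dual_part 1 = 0" "dual_part (a + b) = dual_part a + dual_part b"
  "dual_part (a - b) = dual_part a - dual_part b"
  "dual_part (a * b) = std_part a * dual_part b + dual_part a * std_part b"
  by (simp_all add: zero_dual_number_def one_dual_number_def plus_dual_number_def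
      minus_dual_number_def times_dual_number_def)

interpretation std_part: comm_ring_hom "std_part :: 'a :: comm_ring_1 dual_number \<Rightarrow> 'a"
  by unfold_locales auto

lemma dual_part_sum: "dual_part (sum f S) = (\<Sum>i\<in>S. dual_part (f i))"
  by (induction S rule: infinite_finite_induct) auto

interpretation dual_complex: inj_comm_ring_hom dual_complex
proof unfold_locales
  show "x = 0" if "dual_complex x = 0" for x
    using that by (cases x) (simp add: zero_dual_number_def)
qed (auto intro!: dual_number.expand simp: dual_number.map_sel)

lemma dual_vec_eq_iff:
  "x = y \<longleftrightarrow> map_vec std_part x = map_vec std_part y \<and> map_vec dual_part x = map_vec dual_part y"
  by (auto simp: vec_eq_iff intro: dual_number.expand)

text \<open>The product rule: taking dual parts is a derivation over the ring homomorphism \<open>std_part\<close>.\<close>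

lemma dual_part_mult_mat_vec:
  fixes A :: "'a :: comm_ring_1 dual_number mat"
  assumes A: "A \<in> carrier_mat n n" and x: "x \<in> carrier_vec n"
  shows "map_vec dual_part (A *\<^sub>v x) =
    map_mat std_part A *\<^sub>v map_vec dual_part x + map_mat dual_part A *\<^sub>v map_vec std_part x"
    (is "?l = ?S *\<^sub>v ?d + ?D *\<^sub>v ?s")
proof (rule eq_vecI)
  fix i assume "i < dim_vec (?S *\<^sub>v ?d + ?D *\<^sub>v ?s)"
  hence i: "i < n" using A by simp
  have S: "?S \<in> carrier_mat n n" "?D \<in> carrier_mat n n" using A by auto
  have v: "?s \<in> carrier_vec n" "?d \<in> carrier_vec n" using x by auto
  have "?l $ i = dual_part ((A *\<^sub>v x) $ i)" using i A by simp
  also have "\<dots> = (\<Sum>j<n. ?S $$ (i,j) * ?d $ j) + (\<Sum>j<n. ?D $$ (i,j) * ?s $ j)"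
    unfolding mult_mat_vec_index_sum[OF A x i] dual_part_sum sum.distrib[symmetric]
    using i A x by (intro sum.cong) auto
  also have "\<dots> = (?S *\<^sub>v ?d + ?D *\<^sub>v ?s) $ i"
    using i A mult_mat_vec_index_sum[OF S(1) v(2) i] mult_mat_vec_index_sum[OF S(2) v(1) i]
    by (simp del: index_mult_mat_vec)
  finally show "?l $ i = (?S *\<^sub>v ?d + ?D *\<^sub>v ?s) $ i" .
qed (use A in auto)

text \<open>Comparing coefficients of \<open>1\<close> and \<open>\<epsilon>\<close>: a dual eigenpair is an ordinary eigenpair together with a
solution of the first-order perturbation equation.\<close>

lemma dual_eigen_equation_iff:
  fixes A :: "'a :: comm_ring_1 dual_number mat"
  assumes A: "A \<in> carrier_mat n n" and x: "x \<in> carrier_vec n"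
  defines "xs \<equiv> map_vec std_part x" and "xd \<equiv> map_vec dual_part x"
  shows "A *\<^sub>v x = lam \<cdot>\<^sub>v x \<longleftrightarrow>
    map_mat std_part A *\<^sub>v xs = std_part lam \<cdot>\<^sub>v xs \<and>
    map_mat std_part A *\<^sub>v xd + map_mat dual_part A *\<^sub>v xs = std_part lam \<cdot>\<^sub>v xd + dual_part lam \<cdot>\<^sub>v xs"
proof -
  have "map_vec dual_part (lam \<cdot>\<^sub>v x) = std_part lam \<cdot>\<^sub>v xd + dual_part lam \<cdot>\<^sub>v xs"
    by (auto simp: xs_def xd_def vec_eq_iff)
  moreover have "map_vec std_part (lam \<cdot>\<^sub>v x) = std_part lam \<cdot>\<^sub>v xs"
    by (auto simp: xs_def vec_eq_iff)
  ultimately show ?thesis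
    unfolding dual_vec_eq_iff[of "A *\<^sub>v x"] std_part.mult_mat_vec_hom[OF A x]
      dual_part_mult_mat_vec[OF A x] xs_def xd_def by simp
qed

text \<open>The embedding of dual numbers into dual complex numbers is an injective ring homomorphism, so the
complex eigenvalue equation for real data is the real one; and a positive standard part makes a
dual number positive.\<close>

lemma pos_dual_eigenvector_iff:
  assumes A: "A \<in> carrier_mat n n" and n: "0 < n"
  shows "pos_dual_eigenvector A x lam \<longleftrightarrow>
    x \<in> carrier_vec n \<and> (\<forall>i<n. 0 < std_part (x $ i)) \<and> A *\<^sub>v x = lam \<cdot>\<^sub>v x"
proof -
  have "A *\<^sub>v x = lam \<cdot>\<^sub>v x \<longleftrightarrow>
      map_mat dual_complex A *\<^sub>v map_vec dual_complex x = dual_complex lam \<cdot>\<^sub>v map_vec dual_complex x"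
    if x: "x \<in> carrier_vec n"
    unfolding dual_complex.mult_mat_vec_hom[OF A x, symmetric] dual_complex.vec_hom_smult[symmetric]
    by (metis dual_complex.vec_hom_inj)
  moreover have "map_vec std_part (map_vec dual_complex x) \<noteq> 0\<^sub>v n"
    if "x \<in> carrier_vec n" "\<forall>i<n. 0 < std_part (x $ i)"
    using that n by (auto simp: vec_eq_iff dual_number.map_sel intro!: exI[of _ 0])
  ultimately show ?thesis
    using A by (auto simp: pos_dual_eigenvector_def dual_eigenvector_def less_dual_number_def)
qed

lemma dual_norm2_eq_one_iff:
  assumes x: "x \<in> carrier_vec n"
  defines "xs \<equiv> map_vec std_part x" and "xd \<equiv> map_vec dual_part x"
  shows "dual_norm2 (map_vec dual_complex x) = 1 \<longleftrightarrow> xs \<bullet> xs = 1 \<and> xs \<bullet> xd = 0"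
proof -
  define r where "r = sqrt (xs \<bullet> xs)"
  let ?c = "map_vec complex_of_real"
  have parts: "map_vec std_part (map_vec dual_complex x) = ?c xs"
      "map_vec dual_part (map_vec dual_complex x) = ?c xd"
    by (auto simp: xs_def xd_def vec_eq_iff dual_number.map_sel)
  have "(\<Sum>i<n. (cmod (?c xs $ i))\<^sup>2) = xs \<bullet> xs"
    using x by (auto simp: scalar_prod_def xs_def power2_eq_square atLeast0LessThan intro!: sum.cong)
  moreover have "?c xd \<bullet>c ?c xs = of_real (xs \<bullet> xd)"
    using x by (auto simp: scalar_prod_def xs_def xd_def mult.commute intro!: sum.cong)
  ultimately have "dual_norm2 (map_vec dual_complex x) = Dual (of_real r) (of_real (xs \<bullet> xd / r))"
    using x unfolding dual_norm2_def Let_def parts by (simp add: r_def)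
  also have "\<dots> = 1 \<longleftrightarrow> r = 1 \<and> xs \<bullet> xd = 0"
    by (auto simp: one_dual_number_def)
  finally show ?thesis by (simp add: r_def)
qed

text \<open>Dual numbers do not form an ordered ring with strict monotonicity (\<open>\<epsilon> * \<epsilon> = 0\<close> although \<open>\<epsilon> > 0\<close>), but
weights with positive standard part still behave as expected.  If all \<open>t i\<close> were positive, the
standard part of the sum would force all of them to be infinitesimal, and then only the dual parts
of the \<open>t i\<close> contribute to the dual part of the sum.\<close>

lemma weighted_sum_zero_imp_nonpos:
  fixes Y t :: "nat \<Rightarrow> real dual_number"
  assumes n: "0 < n" and Y: "\<And>i. i < n \<Longrightarrow> 0 < std_part (Y i)"
    and zero: "(\<Sum>i<n. Y i * t i) = 0"
  shows "\<exists>i<n. t i \<le> 0"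
proof (rule ccontr)
  assume "\<not> ?thesis"
  hence t: "0 < t i" if "i < n" for i using that by force
  hence t0: "0 \<le> std_part (t i)" if "i < n" for i using that by (force simp: less_dual_number_def)
  have "(\<Sum>i<n. std_part (Y i) * std_part (t i)) = 0"
    using arg_cong[OF zero, of std_part] by (simp add: std_part.hom_sum)
  hence *: "std_part (Y i) * std_part (t i) = 0" if "i < n" for i
    using sum_nonneg_0[of "{..<n}" "\<lambda>i. std_part (Y i) * std_part (t i)" i] that t0 Y
    by (simp add: less_imp_le)
  have ts: "std_part (t i) = 0" if "i < n" for i using *[OF that] Y[OF that] by simp
  hence td: "0 < dual_part (t i)" if "i < n" for i using t[OF that] that by (simp add: less_dual_number_def)
  have "(\<Sum>i<n. std_part (Y i) * dual_part (t i)) = dual_part (\<Sum>i<n. Y i * t i)"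
    unfolding dual_part_sum using ts by (intro sum.cong) auto
  hence "(\<Sum>i<n. std_part (Y i) * dual_part (t i)) = 0" using zero by simp
  moreover have "0 < (\<Sum>i<n. std_part (Y i) * dual_part (t i))"
    using n Y td by (intro sum_pos mult_pos_pos) auto
  ultimately show False by simp
qed

lemma dual_diff_le_0_iff: "a - b \<le> 0 \<longleftrightarrow> a \<le> (b :: real dual_number)"
  by (auto simp: less_eq_dual_number_def)

text \<open>Pairing \<open>Y\<^sup>T A = lam Y\<^sup>T\<close> with the all-ones vector exhibits \<open>lam\<close> as the average of the row sums with
the weights \<open>Y\<close>.  The usual argument, which compares \<open>x\<close> with its largest coordinate in a row of
\<open>A x = lam x\<close>, breaks down here: an entry of \<open>A\<close> with standard part 0 may have a negative dual part,
so multiplication by it can reverse inequalities.\<close>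

lemma row_sums_bound_eigenvalue:
  fixes A :: "real dual_number mat"
  assumes A: "A \<in> carrier_mat n n" and n: "0 < n"
    and Y: "Y \<in> carrier_vec n" "\<And>i. i < n \<Longrightarrow> 0 < std_part (Y $ i)"
    and left: "transpose_mat A *\<^sub>v Y = lam \<cdot>\<^sub>v Y"
  shows "Min ((\<lambda>i. \<Sum>j<n. A $$ (i, j)) ` {..<n}) \<le> lam"
    and "lam \<le> Max ((\<lambda>i. \<Sum>j<n. A $$ (i, j)) ` {..<n})"
proof -
  define R where "R i = (\<Sum>j<n. A $$ (i, j))" for i
  have At: "transpose_mat A \<in> carrier_mat n n" using A by simp
  have "(\<Sum>i<n. Y $ i * R i) = (\<Sum>j<n. \<Sum>i<n. transpose_mat A $$ (j, i) * Y $ i)"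
    unfolding R_def sum_distrib_left using A by (subst sum.swap) (auto intro!: sum.cong simp: mult.commute)
  also have "\<dots> = (\<Sum>j<n. lam * Y $ j)"
    using mult_mat_vec_index_sum[OF At Y(1)] left Y(1) by (intro sum.cong) auto
  finally have sum: "(\<Sum>i<n. Y $ i * (R i - lam)) = 0"
    by (simp add: right_diff_distrib sum_subtractf mult.commute)
  obtain i where i: "i < n" "R i - lam \<le> 0"
    using weighted_sum_zero_imp_nonpos[OF n Y(2) sum] by blast
  have "(\<Sum>i<n. Y $ i * - (R i - lam)) = 0"
    unfolding mult_minus_right sum_negf sum by simp
  from weighted_sum_zero_imp_nonpos[OF n Y(2) this]
  obtain k where k: "k < n" "- (R k - lam) \<le> 0" by blast
  show "Min ((\<lambda>i. \<Sum>j<n. A $$ (i, j)) ` {..<n}) \<le> lam"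
    using i unfolding R_def dual_diff_le_0_iff by (intro Min.coboundedI[THEN order_trans]) auto
  have "lam - R k \<le> 0" using k(2) by simp
  thus "lam \<le> Max ((\<lambda>i. \<Sum>j<n. A $$ (i, j)) ` {..<n})"
    using k(1) unfolding R_def dual_diff_le_0_iff by (elim order_trans) (intro Max_ge, auto)
qed

section \<open>Eigenpairs of irreducible dual number matrices\<close>

locale irreducible_dual =
  fixes n :: nat and A :: "real dual_number mat"
  assumes A: "A \<in> carrier_mat n n"
    and std: "irreducible_nonneg n (map_mat std_part A)"
begin

abbreviation "As \<equiv> map_mat std_part A"
abbreviation "Ad \<equiv> map_mat dual_part A"

sublocale std: irreducible_nonneg n As by (rule std)

lemma irreducible_dual_transpose: "irreducible_dual n (transpose_mat A)"
proof (rule irreducible_dual.intro)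
  have "map_mat std_part (transpose_mat A) = transpose_mat As" by (auto simp: mat_eq_iff)
  thus "irreducible_nonneg n (map_mat std_part (transpose_mat A))"
    using std.irreducible_nonneg_transpose by simp
qed (use A in simp)

text \<open>Every left Perron vector \<open>y\<close> annihilates the range of \<open>As - a\<close>; the stated dual part of the
eigenvalue is the one value for which the right-hand side of the first-order equation is
orthogonal to \<open>y\<close>, hence for which the equation can be solved.  Applied to the transpose with the
roles of \<open>x\<close> and \<open>y\<close> exchanged, the lemma yields a left eigenvector for the same dual eigenvalue.\<close>

lemma positive_dual_eigenvector:
  assumes x: "x \<in> carrier_vec n" "\<And>i. i < n \<Longrightarrow> 0 < x $ i" "As *\<^sub>v x = a \<cdot>\<^sub>v x"
    and y: "y \<in> carrier_vec n" "\<And>i. i < n \<Longrightarrow> 0 < y $ i" "transpose_mat As *\<^sub>v y = a \<cdot>\<^sub>v y"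
  obtains X where "X \<in> carrier_vec n" "\<And>i. i < n \<Longrightarrow> 0 < std_part (X $ i)"
    "A *\<^sub>v X = Dual a (y \<bullet> (Ad *\<^sub>v x) / (y \<bullet> x)) \<cdot>\<^sub>v X"
proof -
  interpret simple: simple_eigenpair n As a x y by (rule std.positive_eigenpair_simple[OF x y])
  define l where "l = y \<bullet> (Ad *\<^sub>v x) / (y \<bullet> x)"
  have D: "Ad \<in> carrier_mat n n" using A by simp
  have Dx: "Ad *\<^sub>v x \<in> carrier_vec n" using D x(1) by simp
  have "y \<bullet> (l \<cdot>\<^sub>v x - Ad *\<^sub>v x) = 0"
    using x(1) y(1) Dx simple.yx by (simp add: scalar_prod_minus_distrib[of y n] l_def)
  with simple.solvable[of "l \<cdot>\<^sub>v x - Ad *\<^sub>v x"] x(1) Dx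
  obtain z where z: "z \<in> carrier_vec n" "As *\<^sub>v z = a \<cdot>\<^sub>v z + (l \<cdot>\<^sub>v x - Ad *\<^sub>v x)" by auto
  define X where "X = vec n (\<lambda>i. Dual (x $ i) (z $ i))"
  have X: "X \<in> carrier_vec n" "map_vec std_part X = x" "map_vec dual_part X = z"
    using x(1) z(1) by (auto simp: X_def vec_eq_iff)
  have "As *\<^sub>v z + Ad *\<^sub>v x = a \<cdot>\<^sub>v z + l \<cdot>\<^sub>v x"
    unfolding z(2) using x(1) z(1) Dx A by (intro eq_vecI) (auto simp del: index_mult_mat_vec)
  hence "A *\<^sub>v X = Dual a l \<cdot>\<^sub>v X"
    using dual_eigen_equation_iff[OF A X(1)] x(3) X by simp
  moreover have "0 < std_part (X $ i)" if "i < n" for i using that x(2) by (simp add: X_def)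
  ultimately show ?thesis using that X(1) unfolding l_def by blast
qed

text \<open>Pairing the first-order equation with \<open>y\<close> eliminates the unknown dual part of the eigenvector.\<close>

lemma dual_part_eigenvalue:
  assumes X: "X \<in> carrier_vec n" "A *\<^sub>v X = lam \<cdot>\<^sub>v X"
    and y: "y \<in> carrier_vec n" "transpose_mat As *\<^sub>v y = std_part lam \<cdot>\<^sub>v y"
  shows "y \<bullet> (Ad *\<^sub>v map_vec std_part X) = dual_part lam * (y \<bullet> map_vec std_part X)"
proof -
  let ?x = "map_vec std_part X" and ?d = "map_vec dual_part X"
  have D: "Ad \<in> carrier_mat n n" "As \<in> carrier_mat n n" using A by auto
  have v: "?x \<in> carrier_vec n" "?d \<in> carrier_vec n" "Ad *\<^sub>v ?x \<in> carrier_vec n" "As *\<^sub>v ?d \<in> carrier_vec n"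
    using X D by auto
  have "As *\<^sub>v ?d + Ad *\<^sub>v ?x = std_part lam \<cdot>\<^sub>v ?d + dual_part lam \<cdot>\<^sub>v ?x"
    using X dual_eigen_equation_iff[OF A X(1)] by simp
  hence "y \<bullet> (As *\<^sub>v ?d + Ad *\<^sub>v ?x) = y \<bullet> (std_part lam \<cdot>\<^sub>v ?d + dual_part lam \<cdot>\<^sub>v ?x)" by (rule arg_cong)
  hence "y \<bullet> (As *\<^sub>v ?d) + y \<bullet> (Ad *\<^sub>v ?x) = std_part lam * (y \<bullet> ?d) + dual_part lam * (y \<bullet> ?x)"
    using v y(1) by (simp add: scalar_prod_add_distrib[of y n])
  moreover have "y \<bullet> (As *\<^sub>v ?d) = std_part lam * (y \<bullet> ?d)"
    unfolding transpose_vec_mult_scalar[OF D(2) v(2) y(1), symmetric] y(2) using v y(1) by simp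
  ultimately show ?thesis by simp
qed

lemma dual_part_eigenvector_equation:
  assumes X: "X \<in> carrier_vec n" "A *\<^sub>v X = lam \<cdot>\<^sub>v X"
  shows "(As - std_part lam \<cdot>\<^sub>m 1\<^sub>m n) *\<^sub>v map_vec dual_part X =
    (dual_part lam \<cdot>\<^sub>m 1\<^sub>m n - Ad) *\<^sub>v map_vec std_part X"
proof -
  let ?x = "map_vec std_part X" and ?d = "map_vec dual_part X"
  have D: "Ad \<in> carrier_mat n n" "As \<in> carrier_mat n n" "k \<cdot>\<^sub>m 1\<^sub>m n \<in> carrier_mat n n" for k :: real
    using A by auto
  have v: "?x \<in> carrier_vec n" "?d \<in> carrier_vec n" "Ad *\<^sub>v ?x \<in> carrier_vec n" "As *\<^sub>v ?d \<in> carrier_vec n"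
    using X D by auto
  have eq: "As *\<^sub>v ?d + Ad *\<^sub>v ?x = std_part lam \<cdot>\<^sub>v ?d + dual_part lam \<cdot>\<^sub>v ?x"
    using X dual_eigen_equation_iff[OF A X(1)] by simp
  have "As *\<^sub>v ?d - std_part lam \<cdot>\<^sub>v ?d = dual_part lam \<cdot>\<^sub>v ?x - Ad *\<^sub>v ?x"
  proof (rule eq_vecI)
    fix i assume "i < dim_vec (dual_part lam \<cdot>\<^sub>v ?x - Ad *\<^sub>v ?x)"
    hence i: "i < n" using A by simp
    have "(As *\<^sub>v ?d) $ i + (Ad *\<^sub>v ?x) $ i = std_part lam * ?d $ i + dual_part lam * ?x $ i"
      using arg_cong[OF eq, of "\<lambda>w. w $ i"] i v X(1) A by (simp del: index_mult_mat_vec index_map_vec)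
    thus "(As *\<^sub>v ?d - std_part lam \<cdot>\<^sub>v ?d) $ i = (dual_part lam \<cdot>\<^sub>v ?x - Ad *\<^sub>v ?x) $ i"
      using i v X(1) A by (simp del: index_mult_mat_vec index_map_vec)
  qed (use v A in simp)
  thus ?thesis
    unfolding minus_mult_distrib_mat_vec[OF D(2,3) v(2)] minus_mult_distrib_mat_vec[OF D(3,1) v(1)]
      smult_one_mult_mat_vec[OF v(1)] smult_one_mult_mat_vec[OF v(2)] .
qed

lemma cmod_std_part_eigenvalue_le:
  assumes "dual_eigenvalue (map_mat dual_complex A) \<mu>"
  shows "cmod (std_part \<mu>) \<le> std.\<rho>"
proof -
  let ?C = "map_mat dual_complex A"
  have C: "?C \<in> carrier_mat n n" using A by simp
  obtain x where x: "x \<in> carrier_vec n" "map_vec std_part x \<noteq> 0\<^sub>v n" "?C *\<^sub>v x = \<mu> \<cdot>\<^sub>v x"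
    using assms A by (auto simp: dual_eigenvalue_def dual_eigenvector_def)
  have "map_mat std_part ?C = map_mat complex_of_real As"
    by (auto simp: mat_eq_iff dual_number.map_sel)
  with x dual_eigen_equation_iff[OF C x(1)]
  have "eigenvector (map_mat complex_of_real As) (map_vec std_part x) (std_part \<mu>)"
    using A by (simp add: eigenvector_def)
  hence "std_part \<mu> \<in> spectrum (map_mat complex_of_real As)"
    by (auto simp: spectrum_def eigenvalue_def)
  thus ?thesis using spectral_radius_mem_max(2)[of "map_mat complex_of_real As" n] A std.n by simp
qed

text \<open>Multiplying by the dual number \<open>s + t \<epsilon>\<close> preserves eigenvectors: \<open>s\<close> normalizes the standard part, and
\<open>t\<close> shifts the dual part along it into its orthogonal complement.\<close>

lemma normalized_dual_eigenvector:
  assumes X: "X \<in> carrier_vec n" "\<And>i. i < n \<Longrightarrow> 0 < std_part (X $ i)" "A *\<^sub>v X = lam \<cdot>\<^sub>v X"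
  obtains Z where "Z \<in> carrier_vec n" "\<And>i. i < n \<Longrightarrow> 0 < std_part (Z $ i)" "A *\<^sub>v Z = lam \<cdot>\<^sub>v Z"
    "map_vec std_part Z \<bullet> map_vec std_part Z = 1" "map_vec std_part Z \<bullet> map_vec dual_part Z = 0"
proof -
  let ?x = "map_vec std_part X" and ?d = "map_vec dual_part X"
  have v: "?x \<in> carrier_vec n" "?d \<in> carrier_vec n" using X by auto
  define q where "q = ?x \<bullet> ?x"
  have q: "0 < q" unfolding q_def scalar_prod_def using X std.n by (intro sum_pos) auto
  define s where "s = 1 / sqrt q"
  have s: "0 < s" "s * s * q = 1" using q by (auto simp: s_def)
  define t where "t = - s * (?x \<bullet> ?d) / q"
  define Z where "Z = Dual s t \<cdot>\<^sub>v X"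
  have Z: "map_vec std_part Z = s \<cdot>\<^sub>v ?x" "map_vec dual_part Z = s \<cdot>\<^sub>v ?d + t \<cdot>\<^sub>v ?x"
    by (auto simp: Z_def vec_eq_iff)
  have "Z \<in> carrier_vec n" using X by (simp add: Z_def)
  moreover have "0 < std_part (Z $ i)" if "i < n" for i
    using that X s by (simp add: Z_def)
  moreover have "A *\<^sub>v Z = Dual s t \<cdot>\<^sub>v (A *\<^sub>v X)"
    unfolding Z_def using A X(1) by (intro eq_vecI) auto
  hence "A *\<^sub>v Z = lam \<cdot>\<^sub>v Z"
    unfolding X(3) Z_def by (simp add: smult_smult_assoc mult.commute)
  moreover have "(s \<cdot>\<^sub>v ?x) \<bullet> (s \<cdot>\<^sub>v ?x) = 1" using s v by (simp add: q_def[symmetric])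
  moreover have "(s \<cdot>\<^sub>v ?x) \<bullet> (s \<cdot>\<^sub>v ?d + t \<cdot>\<^sub>v ?x) = 0"
  proof -
    have "t * q = - s * (?x \<bullet> ?d)" using q by (simp add: t_def)
    hence "s * (s * (?x \<bullet> ?d)) + s * (t * q) = 0" by simp
    moreover have "(s \<cdot>\<^sub>v ?x) \<bullet> (s \<cdot>\<^sub>v ?d + t \<cdot>\<^sub>v ?x) = s * (s * (?x \<bullet> ?d)) + s * (t * q)"
      unfolding q_def using v by (subst scalar_prod_add_distrib[of _ n]) (simp_all add: algebra_simps)
    ultimately show ?thesis by simp
  qed
  ultimately show ?thesis by (intro that[of Z]) (simp_all only: Z)
qed

text \<open>Positive standard parts in a one-dimensional eigenspace with equal norms coincide.  Then the dual
parts solve the same linear system, so they differ by a multiple of the standard part, which the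
orthogonality condition makes zero.\<close>

lemma normalized_dual_eigenvector_unique:
  assumes X: "X \<in> carrier_vec n" "\<And>i. i < n \<Longrightarrow> 0 < std_part (X $ i)" "A *\<^sub>v X = lam \<cdot>\<^sub>v X"
    "map_vec std_part X \<bullet> map_vec std_part X = 1" "map_vec std_part X \<bullet> map_vec dual_part X = 0"
    and Z: "Z \<in> carrier_vec n" "\<And>i. i < n \<Longrightarrow> 0 < std_part (Z $ i)" "A *\<^sub>v Z = lam \<cdot>\<^sub>v Z"
    "map_vec std_part Z \<bullet> map_vec std_part Z = 1" "map_vec std_part Z \<bullet> map_vec dual_part Z = 0"
  shows "X = Z"
proof -
  define x u z v where "x = map_vec std_part X" and "u = map_vec dual_part X"
    and "z = map_vec std_part Z" and "v = map_vec dual_part Z"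
  note defs = x_def u_def z_def v_def
  have c: "x \<in> carrier_vec n" "u \<in> carrier_vec n" "z \<in> carrier_vec n" "v \<in> carrier_vec n"
    using X Z by (auto simp: defs)
  have pos: "0 < x $ i" "0 < z $ i" if "i < n" for i using that X Z by (auto simp: defs)
  have eX: "As *\<^sub>v x = std_part lam \<cdot>\<^sub>v x" "As *\<^sub>v u + Ad *\<^sub>v x = std_part lam \<cdot>\<^sub>v u + dual_part lam \<cdot>\<^sub>v x"
    using X(3) unfolding dual_eigen_equation_iff[OF A X(1)] defs by auto
  have eZ: "As *\<^sub>v z = std_part lam \<cdot>\<^sub>v z" "As *\<^sub>v v + Ad *\<^sub>v z = std_part lam \<cdot>\<^sub>v v + dual_part lam \<cdot>\<^sub>v z"
    using Z(3) unfolding dual_eigen_equation_iff[OF A Z(1)] defs by auto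
  obtain t where t: "z = t \<cdot>\<^sub>v x"
    using std.eigenspace_one_dimensional[OF c(1) pos(1) eX(1) c(3) eZ(1)] by blast
  have "t * (t * (x \<bullet> x)) = z \<bullet> z" unfolding t using c by simp
  hence "t * t = 1" using X(4) Z(4) by (simp add: defs)
  moreover have "0 < t * x $ 0" using pos(2)[OF std.n] t c std.n by simp
  hence "0 < t" using pos(1)[OF std.n] by (simp add: zero_less_mult_iff)
  ultimately have "t = 1" by (metis abs_of_pos real_sqrt_abs2 real_sqrt_one)
  hence zx: "z = x" using t by simp
  have Auv: "As *\<^sub>v u \<in> carrier_vec n" "As *\<^sub>v v \<in> carrier_vec n" "Ad *\<^sub>v x \<in> carrier_vec n"
    using A c by auto
  have "As *\<^sub>v (u - v) = std_part lam \<cdot>\<^sub>v (u - v)"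
  proof (rule eq_vecI)
    fix i assume "i < dim_vec (std_part lam \<cdot>\<^sub>v (u - v))"
    hence i: "i < n" using c by simp
    have "(As *\<^sub>v u) $ i + (Ad *\<^sub>v x) $ i = std_part lam * u $ i + dual_part lam * x $ i"
      using arg_cong[OF eX(2), of "\<lambda>w. w $ i"] i c Auv A by (simp del: index_mult_mat_vec)
    moreover have "(As *\<^sub>v v) $ i + (Ad *\<^sub>v x) $ i = std_part lam * v $ i + dual_part lam * x $ i"
      using arg_cong[OF eZ(2), of "\<lambda>w. w $ i"] i c Auv A by (simp add: zx del: index_mult_mat_vec)
    moreover have "As *\<^sub>v (u - v) = As *\<^sub>v u - As *\<^sub>v v"
      using A c by (intro mult_minus_distrib_mat_vec[of _ n n]) auto
    ultimately show "(As *\<^sub>v (u - v)) $ i = (std_part lam \<cdot>\<^sub>v (u - v)) $ i"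
      using i c A by (simp add: algebra_simps del: index_mult_mat_vec)
  qed (use A c in simp)
  then obtain r where r: "u - v = r \<cdot>\<^sub>v x"
    using std.eigenspace_one_dimensional[OF c(1) pos(1) eX(1), of "u - v"] c by auto
  have "x \<bullet> (u - v) = 0"
    using X(5) Z(5) zx c by (simp add: defs scalar_prod_minus_distrib[of _ n])
  hence "r = 0" unfolding r using c X(4) by (simp add: defs)
  with r c have "u = v" by (auto simp: vec_eq_iff)
  with zx show ?thesis by (simp add: dual_vec_eq_iff defs)
qed

end


section \<open>The Perron eigenpair over the dual numbers\<close>

lemma irreducible_nonnegI:
  assumes "0 < n" and "A \<in> carrier_mat n n" and "nonneg_real_mat A" and "irreducible_mat A"
  shows "irreducible_nonneg n A"
  using assms by unfold_locales (auto simp: nonneg_real_mat_def)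

theorem theorem5p1:
  fixes n :: nat
    and A :: "real dual_number mat"
    and As Ad :: "real mat"
  assumes "0 < n"
    and "A \<in> carrier_mat n n"
    and "As = map_mat std_part A"
    and "Ad = map_mat dual_part A"
    and "nonneg_real_mat As"
    and "irreducible_mat As"
  shows "\<exists>lam :: real dual_number.
    0 < lam \<and> 0 < std_part lam \<and>
    (\<exists>x. pos_dual_eigenvector A x lam) \<and>
    eigenvalue As (std_part lam) \<and> order (std_part lam) (char_poly As) = 1 \<and>
    (\<forall>\<mu>. dual_eigenvalue (map_mat dual_complex A) \<mu> \<and> \<mu> \<noteq> dual_complex lam \<longrightarrow>
         cmod (std_part \<mu>) \<le> std_part lam) \<and>
    (\<exists>y. perron_eigenvector (transpose_mat As) y) \<and>
    (\<forall>x. pos_dual_eigenvector A x lam \<longrightarrow>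
       (let xs = map_vec std_part x; xd = map_vec dual_part x in
         (\<forall>y. perron_eigenvector (transpose_mat As) y \<longrightarrow>
            0 < y \<bullet> xs \<and>
            dual_part lam = (y \<bullet> (Ad *\<^sub>v xs)) / (y \<bullet> xs)) \<and>
         (As - std_part lam \<cdot>\<^sub>m 1\<^sub>m n) *\<^sub>v xd = (dual_part lam \<cdot>\<^sub>m 1\<^sub>m n - Ad) *\<^sub>v xs)) \<and>
    (\<exists>!xd. \<exists>x. pos_dual_eigenvector A x lam \<and> dual_norm2 (map_vec dual_complex x) = 1 \<and>
                xd = map_vec dual_part x) \<and>
    Min ((\<lambda>i. \<Sum>j<n. A $$ (i, j)) ` {..<n}) \<le> lam \<and>
    lam \<le> Max ((\<lambda>i. \<Sum>j<n. A $$ (i, j)) ` {..<n})"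
proof -
  note n = assms(1) and A = assms(2) and As = assms(3) and Ad = assms(4)
  have As_carrier: "As \<in> carrier_mat n n" and Ad_carrier: "Ad \<in> carrier_mat n n"
    using A As Ad by auto
  have perron: "irreducible_nonneg n As"
    using irreducible_nonnegI[OF n As_carrier] assms(5,6) by blast
  interpret D: irreducible_dual n A
    by (rule irreducible_dual.intro[OF A perron[unfolded As]])
  interpret T: irreducible_dual n "transpose_mat A"
    by (rule D.irreducible_dual_transpose)
  have transposed: "map_mat std_part (transpose_mat A) = transpose_mat As"
      "map_mat dual_part (transpose_mat A) = transpose_mat Ad"
    by (auto simp: As Ad mat_eq_iff)
  define \<rho> where "\<rho> = spectral_radius (map_mat complex_of_real As)"
  have \<rho>: "0 < \<rho>" using D.std.spectral_radius_pos by (simp add: \<rho>_def As)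
  obtain x where x: "x \<in> carrier_vec n" "\<And>i. i < n \<Longrightarrow> 0 < x $ i" "As *\<^sub>v x = \<rho> \<cdot>\<^sub>v x"
    using D.std.positive_eigenvector unfolding \<rho>_def As by blast
  obtain y where y: "y \<in> carrier_vec n" "\<And>i. i < n \<Longrightarrow> 0 < y $ i"
      "transpose_mat As *\<^sub>v y = \<rho> \<cdot>\<^sub>v y"
    using D.std.positive_left_eigenvector unfolding \<rho>_def As by blast
  interpret simple: simple_eigenpair n As \<rho> x y
    by (rule irreducible_nonneg.positive_eigenpair_simple[OF perron x y])
  define l where "l = y \<bullet> (Ad *\<^sub>v x) / (y \<bullet> x)"
  define lam where "lam = Dual \<rho> l"
  have lam: "std_part lam = \<rho>" "dual_part lam = l" by (simp_all add: lam_def)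
  note eigenvector_iff = pos_dual_eigenvector_iff[OF A n]
  obtain X where X: "X \<in> carrier_vec n" "\<And>i. i < n \<Longrightarrow> 0 < std_part (X $ i)" "A *\<^sub>v X = lam \<cdot>\<^sub>v X"
    using D.positive_dual_eigenvector[OF x[unfolded As] y[unfolded As]]
    unfolding lam_def l_def Ad by blast
  have l': "x \<bullet> (transpose_mat Ad *\<^sub>v y) / (x \<bullet> y) = l"
  proof -
    have "x \<bullet> (transpose_mat Ad *\<^sub>v y) = y \<bullet> (Ad *\<^sub>v x)"
      using transpose_vec_mult_scalar[OF Ad_carrier x(1) y(1)] Ad_carrier x(1) y(1)
      by (metis comm_scalar_prod mult_mat_vec_carrier transpose_carrier_mat)
    moreover have "x \<bullet> y = y \<bullet> x" using x(1) y(1) by (rule comm_scalar_prod)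
    ultimately show ?thesis by (simp add: l_def)
  qed
  obtain Y where Y: "Y \<in> carrier_vec n" "\<And>i. i < n \<Longrightarrow> 0 < std_part (Y $ i)"
      "transpose_mat A *\<^sub>v Y = lam \<cdot>\<^sub>v Y"
    using T.positive_dual_eigenvector[unfolded transposed Matrix.transpose_transpose, OF y x]
    unfolding l' lam_def[symmetric] by blast
  have eigenvalue: "eigenvalue As \<rho>"
  proof -
    have "x \<noteq> 0\<^sub>v n" using x(2)[OF n] n by auto
    thus ?thesis using x As_carrier unfolding eigenvalue_def eigenvector_def by auto
  qed
  have perron_iff: "perron_eigenvector (transpose_mat As) v \<longleftrightarrow>
      v \<in> carrier_vec n \<and> (\<forall>i<n. 0 < v $ i) \<and> transpose_mat As *\<^sub>v v = \<rho> \<cdot>\<^sub>v v" for v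
  proof -
    have "v \<noteq> 0\<^sub>v n" if "\<forall>i<n. 0 < v $ i" using that n by auto
    thus ?thesis
      using As_carrier irreducible_nonneg.spectral_radius_transpose[OF perron]
      unfolding perron_eigenvector_def eigenvector_def \<rho>_def by auto
  qed
  have first_order: "let xs = map_vec std_part v; xd = map_vec dual_part v in
         (\<forall>y. perron_eigenvector (transpose_mat As) y \<longrightarrow>
            0 < y \<bullet> xs \<and>
            dual_part lam = (y \<bullet> (Ad *\<^sub>v xs)) / (y \<bullet> xs)) \<and>
         (As - std_part lam \<cdot>\<^sub>m 1\<^sub>m n) *\<^sub>v xd = (dual_part lam \<cdot>\<^sub>m 1\<^sub>m n - Ad) *\<^sub>v xs"
    if "pos_dual_eigenvector A v lam" for v
  proof -
    from that have v: "v \<in> carrier_vec n" "\<And>i. i < n \<Longrightarrow> 0 < std_part (v $ i)" "A *\<^sub>v v = lam \<cdot>\<^sub>v v"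
      unfolding eigenvector_iff by auto
    have "0 < w \<bullet> map_vec std_part v \<and>
        dual_part lam = (w \<bullet> (Ad *\<^sub>v map_vec std_part v)) / (w \<bullet> map_vec std_part v)"
      if "perron_eigenvector (transpose_mat As) w" for w
    proof -
      from that have w: "w \<in> carrier_vec n" "\<And>i. i < n \<Longrightarrow> 0 < w $ i"
          "transpose_mat As *\<^sub>v w = \<rho> \<cdot>\<^sub>v w"
        unfolding perron_iff by auto
      have "0 < w \<bullet> map_vec std_part v"
        unfolding scalar_prod_def using v(1,2) w(1,2) n by (intro sum_pos) auto
      moreover have "w \<bullet> (Ad *\<^sub>v map_vec std_part v) = dual_part lam * (w \<bullet> map_vec std_part v)"
        unfolding Ad using w(3) by (intro D.dual_part_eigenvalue v(1,3) w(1)) (simp add: lam As)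
      ultimately show ?thesis by simp
    qed
    with D.dual_part_eigenvector_equation[OF v(1,3)] show ?thesis
      unfolding Let_def As Ad by blast
  qed
  have normalized: "\<exists>!xd. \<exists>x. pos_dual_eigenvector A x lam \<and>
      dual_norm2 (map_vec dual_complex x) = 1 \<and> xd = map_vec dual_part x"
  proof -
    obtain Z where Z: "Z \<in> carrier_vec n" "\<And>i. i < n \<Longrightarrow> 0 < std_part (Z $ i)" "A *\<^sub>v Z = lam \<cdot>\<^sub>v Z"
        "map_vec std_part Z \<bullet> map_vec std_part Z = 1" "map_vec std_part Z \<bullet> map_vec dual_part Z = 0"
      using D.normalized_dual_eigenvector[OF X] by blast
    have "v = Z" if "pos_dual_eigenvector A v lam" "dual_norm2 (map_vec dual_complex v) = 1" for v
    proof -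
      from that(1) have v: "v \<in> carrier_vec n" "\<And>i. i < n \<Longrightarrow> 0 < std_part (v $ i)" "A *\<^sub>v v = lam \<cdot>\<^sub>v v"
        unfolding eigenvector_iff by auto
      show ?thesis
        using that(2) D.normalized_dual_eigenvector_unique[OF v _ _ Z]
        unfolding dual_norm2_eq_one_iff[OF v(1)] by blast
    qed
    moreover have "pos_dual_eigenvector A Z lam" "dual_norm2 (map_vec dual_complex Z) = 1"
      using Z unfolding eigenvector_iff dual_norm2_eq_one_iff[OF Z(1)] by auto
    ultimately show ?thesis by blast
  qed
  show ?thesis
  proof (intro exI[of _ lam] conjI allI impI)
    show "0 < lam" using \<rho> by (simp add: less_dual_number_def lam)
    show "0 < std_part lam" using \<rho> by (simp add: lam)
    show "\<exists>x. pos_dual_eigenvector A x lam" using X unfolding eigenvector_iff by blast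
    show "eigenvalue As (std_part lam)" using eigenvalue by (simp add: lam)
    show "order (std_part lam) (char_poly As) = 1" using simple.order_char_poly by (simp add: lam)
    show "\<exists>y. perron_eigenvector (transpose_mat As) y" using y unfolding perron_iff by blast
    show "\<exists>!xd. \<exists>x. pos_dual_eigenvector A x lam \<and>
      dual_norm2 (map_vec dual_complex x) = 1 \<and> xd = map_vec dual_part x" by (rule normalized)
    show "Min ((\<lambda>i. \<Sum>j<n. A $$ (i, j)) ` {..<n}) \<le> lam"
      by (rule row_sums_bound_eigenvalue(1)[OF A n Y])
    show "lam \<le> Max ((\<lambda>i. \<Sum>j<n. A $$ (i, j)) ` {..<n})"
      by (rule row_sums_bound_eigenvalue(2)[OF A n Y])
  next
    fix \<mu> assume "dual_eigenvalue (map_mat dual_complex A) \<mu> \<and> \<mu> \<noteq> dual_complex lam"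
    with D.cmod_std_part_eigenvalue_le[of \<mu>] show "cmod (std_part \<mu>) \<le> std_part lam"
      by (simp add: lam \<rho>_def As)
  next
    fix v assume "pos_dual_eigenvector A v lam"
    thus "let xs = map_vec std_part v; xd = map_vec dual_part v in
         (\<forall>y. perron_eigenvector (transpose_mat As) y \<longrightarrow>
            0 < y \<bullet> xs \<and>
            dual_part lam = (y \<bullet> (Ad *\<^sub>v xs)) / (y \<bullet> xs)) \<and>
         (As - std_part lam \<cdot>\<^sub>m 1\<^sub>m n) *\<^sub>v xd = (dual_part lam \<cdot>\<^sub>m 1\<^sub>m n - Ad) *\<^sub>v xs"
      by (rule first_order)
  qed
qed

end
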